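(* Let $A\subseteq\mathbb{N}$ be an r.e. set. Then there are infinitely many r.e. sets $B\subseteq\mathbb{N}$ such that $[B]_\sim\subseteq[A]_T$.
   Context: $\mathbb{N}=\{1,2,3,\dots\}$. $[A]_T$ is the Turing-reducibility equivalence class of $A$, i.e. the collection of sets Turing equivalent to $A$. A listing of an r.e. set $A\subseteq\mathbb{N}$ is a bijective computable function onto $A$: if $A$ is infinite it is a total computable bijection $h:\mathbb{N}\to A$; if $A$ is finite with $n$ elements it is a bijection $h:\{1,\dots,n\}\to A$. Two listings $h,g$ with the same domain are uniform, $h\sim g$, if $h(i)<h(j)\Leftrightarrow g(i)<g(j)$ for all $i,j$ in the domain. Two r.e. sets $A,B$ of equal cardinality are uniform, $A\sim B$, if there exist a listing $h$ of $A$ and a listing $g$ of $B$ with $h\sim g$. The uniformity equivalence class of an r.e. set $B$ is $[B]_\sim=\{C\subseteq\mathbb{N}: B\sim C\}$. *)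

theory Defs
  imports Main "HOL-Library.Equipollence"
begin

text \<open>The positive integers play the role of the natural numbers throughout: sets are subsets of
  \<open>positives\<close>, while computability is developed for all of \<^typ>\<open>nat\<close>, a function on
  positive integers being a partial function that is undefined at \<open>0\<close>.\<close>

abbreviation positives :: "nat set" where
  "positives \<equiv> {1..}"

text \<open>A \<open>k\<close>-ary partial function is a map on lists that is undefined on all lists of length
  other than \<open>k\<close>.\<close>

definition pcompose ::
  "nat \<Rightarrow> (nat list \<rightharpoonup> nat) \<Rightarrow> (nat list \<rightharpoonup> nat) list \<Rightarrow> (nat list \<rightharpoonup> nat)" where
  "pcompose k f gs = (\<lambda>xs. if length xs = k \<and> (\<forall>g\<in>set gs. g xs \<noteq> None)
                           then f (map (\<lambda>g. the (g xs)) gs) else None)"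

text \<open>In the recursion step \<open>g\<close> receives the counter, the previous value and the parameters.\<close>

fun prim_rec ::
  "(nat list \<rightharpoonup> nat) \<Rightarrow> (nat list \<rightharpoonup> nat) \<Rightarrow> (nat list \<rightharpoonup> nat)" where
  "prim_rec f g [] = None"
| "prim_rec f g (0 # xs) = f xs"
| "prim_rec f g (Suc n # xs) =
     (case prim_rec f g (n # xs) of None \<Rightarrow> None | Some y \<Rightarrow> g (n # y # xs))"

definition minimize :: "(nat list \<rightharpoonup> nat) \<Rightarrow> (nat list \<rightharpoonup> nat)" where
  "minimize f = (\<lambda>xs. if \<exists>n. f (n # xs) = Some 0 \<and> (\<forall>m<n. f (m # xs) \<noteq> None)
                      then Some (LEAST n. f (n # xs) = Some 0) else None)"

text \<open>\<open>precursive \<Phi> k F\<close>: the \<open>k\<close>-ary partial function \<open>F\<close> is partial recursive relative to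
  the given functions in \<open>\<Phi>\<close>. With \<open>\<Phi> = {}\<close> these are the partial recursive functions.\<close>

inductive precursive :: "(nat \<Rightarrow> nat) set \<Rightarrow> nat \<Rightarrow> (nat list \<rightharpoonup> nat) \<Rightarrow> bool"
  for \<Phi> :: "(nat \<Rightarrow> nat) set" where
  zero: "precursive \<Phi> k (\<lambda>xs. if length xs = k then Some 0 else None)"
| succ: "precursive \<Phi> 1 (\<lambda>xs. if length xs = 1 then Some (Suc (hd xs)) else None)"
| proj: "i < k \<Longrightarrow> precursive \<Phi> k (\<lambda>xs. if length xs = k then Some (xs ! i) else None)"
| base: "\<phi> \<in> \<Phi> \<Longrightarrow> precursive \<Phi> 1 (\<lambda>xs. if length xs = 1 then Some (\<phi> (hd xs)) else None)"
| comp: "precursive \<Phi> (length gs) f \<Longrightarrow> (\<forall>g\<in>set gs. precursive \<Phi> k g)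
           \<Longrightarrow> precursive \<Phi> k (pcompose k f gs)"
| prim: "precursive \<Phi> k f \<Longrightarrow> precursive \<Phi> (k + 2) g \<Longrightarrow> precursive \<Phi> (k + 1) (prim_rec f g)"
| mini: "precursive \<Phi> (k + 1) f \<Longrightarrow> precursive \<Phi> k (minimize f)"

definition computable_in :: "(nat \<Rightarrow> nat) set \<Rightarrow> (nat \<rightharpoonup> nat) \<Rightarrow> bool" where
  "computable_in \<Phi> h \<longleftrightarrow> (\<exists>F. precursive \<Phi> 1 F \<and> (\<forall>x. F [x] = h x))"

abbreviation computable :: "(nat \<rightharpoonup> nat) \<Rightarrow> bool" where
  "computable \<equiv> computable_in {}"

definition re_set :: "nat set \<Rightarrow> bool" where
  "re_set A \<longleftrightarrow> (\<exists>h. computable h \<and> dom h = A)"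

definition char_fun :: "nat set \<Rightarrow> nat \<Rightarrow> nat" where
  "char_fun A x = (if x \<in> A then 1 else 0)"

definition turing_reducible :: "nat set \<Rightarrow> nat set \<Rightarrow> bool" where
  "turing_reducible A B \<longleftrightarrow> computable_in {char_fun B} (\<lambda>x. Some (char_fun A x))"

definition turing_equivalent :: "nat set \<Rightarrow> nat set \<Rightarrow> bool" where
  "turing_equivalent A B \<longleftrightarrow> turing_reducible A B \<and> turing_reducible B A"

definition turing_class :: "nat set \<Rightarrow> nat set set" where
  "turing_class A = {C. C \<subseteq> positives \<and> turing_equivalent A C}"

definition listing :: "(nat \<rightharpoonup> nat) \<Rightarrow> nat set \<Rightarrow> bool" where
  "listing h A \<longleftrightarrow> computable h \<and>
     dom h = (if finite A then {1..card A} else positives) \<and>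
     bij_betw (\<lambda>i. the (h i)) (dom h) A"

definition uniform_listings :: "(nat \<rightharpoonup> nat) \<Rightarrow> (nat \<rightharpoonup> nat) \<Rightarrow> bool" where
  "uniform_listings h g \<longleftrightarrow> dom h = dom g \<and>
     (\<forall>i\<in>dom h. \<forall>j\<in>dom h. the (h i) < the (h j) \<longleftrightarrow> the (g i) < the (g j))"

definition uniform :: "nat set \<Rightarrow> nat set \<Rightarrow> bool" where
  "uniform A B \<longleftrightarrow> re_set A \<and> re_set B \<and> A \<approx> B \<and>
     (\<exists>h g. listing h A \<and> listing g B \<and> uniform_listings h g)"

definition uniformity_class :: "nat set \<Rightarrow> nat set set" where
  "uniformity_class B = {C. C \<subseteq> positives \<and> uniform B C}"

end

theory Submission
  imports Defs
begin

text \<open>Uniform sets are Turing equivalent. Let \<open>h\<close> and \<open>g\<close> be uniform listings of infinite sets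
  \<open>B\<close> and \<open>C\<close>. To decide \<open>x \<in> C\<close> with oracle \<open>B\<close>, find \<open>i\<close> with \<open>g i > x\<close> and then \<open>N\<close> such that
  all the (finitely many) elements of \<open>B\<close> below \<open>h i\<close> are listed by \<open>h\<close> before stage \<open>N\<close>. By
  uniformity \<open>g j = x < g i\<close> implies \<open>h j < h i\<close>, hence \<open>j < N\<close>, so \<open>x \<in> C\<close> iff \<open>x\<close> is listed by
  \<open>g\<close> before stage \<open>N\<close>. It remains to exhibit infinitely many r.e. sets Turing equivalent
  to \<open>A\<close>, namely \<open>{n} \<union> {x + n + 1 | x \<in> A}\<close> for \<open>n \<ge> 1\<close>.\<close>

section \<open>Total relatively recursive functions\<close>

text \<open>Recursive functions become ordinary total functions on lists, with values at lists of
  other lengths disregarded. This lets \<open>intro\<close> prove recursiveness by following the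
  syntax of a term.\<close>

definition total_recursive :: "(nat \<Rightarrow> nat) set \<Rightarrow> nat \<Rightarrow> (nat list \<Rightarrow> nat) \<Rightarrow> bool" where
  "total_recursive \<Phi> k f \<longleftrightarrow> precursive \<Phi> k (\<lambda>xs. if length xs = k then Some (f xs) else None)"

lemma precursive_arity:
  assumes "precursive \<Phi> k F" and "length xs \<noteq> k"
  shows "F xs = None"
  using assms
proof (induction arbitrary: xs)
  case (prim k f g)
  show ?case
  proof (cases xs)
    case (Cons n ys)
    with prim have "length ys \<noteq> k" by simp
    then have "f ys = None" using prim by blast
    \<comment> \<open>Undefinedness of the start value propagates through every recursion
      step.\<close>
    then have "prim_rec f g (n # ys) = None"
      by (induction n) auto
    then show ?thesis using Cons by simp
  qed simp
qed (auto simp: pcompose_def minimize_def)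

text \<open>Each oracle call in a derivation is replaced by a derivation of that oracle from the new
  ones. This yields both enlargement of the oracle set and transitivity of Turing
  reducibility.\<close>

lemma precursive_subst:
  assumes "precursive \<Phi> k F"
    and "\<And>\<phi>. \<phi> \<in> \<Phi> \<Longrightarrow> precursive \<Psi> 1 (\<lambda>xs. if length xs = 1 then Some (\<phi> (hd xs)) else None)"
  shows "precursive \<Psi> k F"
  using assms by (induction) (auto intro: precursive.intros simp del: One_nat_def)

lemma precursive_mono: "precursive {} k F \<Longrightarrow> precursive \<Psi> k F"
  by (rule precursive_subst) auto

lemma total_recursive_cong:
  assumes "total_recursive \<Phi> k f" and "\<And>xs. length xs = k \<Longrightarrow> g xs = f xs"
  shows "total_recursive \<Phi> k g"
proof -
  have "(\<lambda>xs. if length xs = k then Some (f xs) else None)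
      = (\<lambda>xs. if length xs = k then Some (g xs) else None)"
    using assms(2) by auto
  with assms(1) show ?thesis by (simp add: total_recursive_def)
qed

text \<open>The bridge to \<open>computable_in\<close>: by \<open>precursive_arity\<close> a unary
  \<open>F\<close> is determined by its values on one-element lists.\<close>

lemma total_recursive_iff_precursive:
  "total_recursive \<Phi> 1 (\<lambda>xs. \<phi> (hd xs))
     \<longleftrightarrow> (\<exists>F. precursive \<Phi> 1 F \<and> (\<forall>x. F [x] = Some (\<phi> x)))"
proof
  assume "\<exists>F. precursive \<Phi> 1 F \<and> (\<forall>x. F [x] = Some (\<phi> x))"
  then obtain F where F: "precursive \<Phi> 1 F" "\<And>x. F [x] = Some (\<phi> x)" by blast
  have "F = (\<lambda>xs. if length xs = 1 then Some (\<phi> (hd xs)) else None)"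
  proof
    fix xs show "F xs = (if length xs = 1 then Some (\<phi> (hd xs)) else None)"
      using F(2) precursive_arity[OF F(1), of xs] by (cases xs) auto
  qed
  with F(1) show "total_recursive \<Phi> 1 (\<lambda>xs. \<phi> (hd xs))"
    unfolding total_recursive_def by simp
qed (force simp: total_recursive_def)

section \<open>Composition, variables and constants\<close>

lemma total_recursive_comp:
  assumes "total_recursive \<Phi> (length gs) f" and "\<forall>g\<in>set gs. total_recursive \<Phi> k g"
  shows "total_recursive \<Phi> k (\<lambda>xs. f (map (\<lambda>g. g xs) gs))"
proof -
  define lift where "lift g = (\<lambda>xs. if length xs = k then Some (g xs) else None)"
    for g :: "nat list \<Rightarrow> nat"
  have "precursive \<Phi> k (pcompose k
      (\<lambda>xs. if length xs = length gs then Some (f xs) else None) (map lift gs))"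
    using assms by (intro precursive.comp) (auto simp: total_recursive_def lift_def)
  moreover have "pcompose k (\<lambda>xs. if length xs = length gs then Some (f xs) else None) (map lift gs)
      = (\<lambda>xs. if length xs = k then Some (f (map (\<lambda>g. g xs) gs)) else None)"
    by (rule ext) (auto simp: pcompose_def lift_def comp_def)
  ultimately show ?thesis by (simp add: total_recursive_def)
qed

lemma total_recursive_comp1:
  assumes "total_recursive \<Phi> 1 (\<lambda>xs. \<phi> (hd xs))" and "total_recursive \<Phi> k f"
  shows "total_recursive \<Phi> k (\<lambda>xs. \<phi> (f xs))"
  using total_recursive_comp[of \<Phi> "[f]" "\<lambda>xs. \<phi> (hd xs)" k] assms by simp

lemma total_recursive_nth: "i < k \<Longrightarrow> total_recursive \<Phi> k (\<lambda>xs. xs ! i)"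
  unfolding total_recursive_def by (rule precursive.proj)

lemma total_recursive_hd: "total_recursive \<Phi> (Suc k) (\<lambda>xs. hd xs)"
  by (rule total_recursive_cong[OF total_recursive_nth[of 0 "Suc k"]]) (auto simp: length_Suc_conv)

text \<open>Weakening by a fresh first argument: \<open>tl xs\<close> is a list of projections, so
  composition applies. Argument lists thus act as contexts, with the innermost bound variable at the
  head.\<close>

lemma total_recursive_tl:
  assumes "total_recursive \<Phi> k f"
  shows "total_recursive \<Phi> (Suc k) (\<lambda>xs. f (tl xs))"
proof -
  have tl: "map (\<lambda>g. g xs) (map (\<lambda>i xs. xs ! Suc i) [0..<k]) = tl xs"
    if "length xs = Suc k" for xs :: "nat list"
    using that by (auto intro!: nth_equalityI simp: nth_tl)
  have "total_recursive \<Phi> (Suc k) (\<lambda>xs. f (map (\<lambda>g. g xs) (map (\<lambda>i xs. xs ! Suc i) [0..<k])))"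
    by (rule total_recursive_comp) (auto intro: total_recursive_nth assms)
  then show ?thesis
    by (rule total_recursive_cong) (simp only: tl)
qed

lemmas total_recursive_vars = total_recursive_hd
  total_recursive_tl[OF total_recursive_hd]
  total_recursive_tl[OF total_recursive_tl[OF total_recursive_hd]]
  total_recursive_tl[OF total_recursive_tl[OF total_recursive_tl[OF total_recursive_hd]]]

lemma total_recursive_Suc:
  "total_recursive \<Phi> k f \<Longrightarrow> total_recursive \<Phi> k (\<lambda>xs. Suc (f xs))"
  by (rule total_recursive_comp1[of _ Suc]) (use precursive.succ in \<open>auto simp: total_recursive_def\<close>)

lemma total_recursive_const: "total_recursive \<Phi> k (\<lambda>_. c)"
proof (induction c)
  case 0
  show ?case unfolding total_recursive_def by (rule precursive.zero)
qed (rule total_recursive_Suc)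

lemma total_recursive_oracle:
  "\<phi> \<in> \<Phi> \<Longrightarrow> total_recursive \<Phi> k f \<Longrightarrow> total_recursive \<Phi> k (\<lambda>xs. \<phi> (f xs))"
  by (rule total_recursive_comp1) (use precursive.base in \<open>auto simp: total_recursive_def\<close>)

section \<open>Recursion, minimization and arithmetic\<close>

lemma total_recursive_rec_nat:
  assumes f: "total_recursive \<Phi> k f"
    and g: "total_recursive \<Phi> (Suc (Suc k)) (\<lambda>xs. g (hd xs) (hd (tl xs)) (tl (tl xs)))"
    and c: "total_recursive \<Phi> k c"
  shows "total_recursive \<Phi> k (\<lambda>xs. rec_nat (f xs) (\<lambda>n y. g n y xs) (c xs))"
proof -
  define F where "F = (\<lambda>xs. if length xs = k then Some (f xs) else None)"
  define G where "G = (\<lambda>xs. if length xs = Suc (Suc k)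
    then Some (g (hd xs) (hd (tl xs)) (tl (tl xs))) else None)"
  define r where "r = (\<lambda>xs. rec_nat (f (tl xs)) (\<lambda>n y. g n y (tl xs)) (hd xs))"
  have rec: "prim_rec F G (n # xs) =
      (if length xs = k then Some (rec_nat (f xs) (\<lambda>n y. g n y xs) n) else None)" for n xs
    by (induction n) (auto simp: F_def G_def)
  have "prim_rec F G = (\<lambda>xs. if length xs = Suc k then Some (r xs) else None)"
  proof
    fix xs show "prim_rec F G xs = (if length xs = Suc k then Some (r xs) else None)"
      using rec by (cases xs) (auto simp: r_def)
  qed
  moreover have "precursive \<Phi> (k + 1) (prim_rec F G)"
    using f g by (intro precursive.prim) (simp_all add: total_recursive_def F_def G_def)
  ultimately have r: "total_recursive \<Phi> (Suc k) r"
    by (simp add: total_recursive_def)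
  \<comment> \<open>\<open>prim_rec\<close> counts down its first argument; composing with
    \<open>gs\<close> puts \<open>c xs\<close> there and keeps \<open>xs\<close> as the
    parameters.\<close>
  define gs where "gs = c # map (\<lambda>i xs. xs ! i) [0..<k]"
  have gs: "map (\<lambda>g. g xs) gs = c xs # xs" if "length xs = k" for xs
    using that by (auto simp: gs_def intro!: nth_equalityI)
  have "total_recursive \<Phi> k (\<lambda>xs. r (map (\<lambda>g. g xs) gs))"
    by (rule total_recursive_comp) (auto simp: gs_def c r intro: total_recursive_nth)
  then show ?thesis
    by (rule total_recursive_cong) (simp add: gs r_def)
qed

text \<open>\<open>minimize\<close> searches for a zero, so the truth value is first flipped by a
  recursion sending 1 to 0 and 0 to 1. The hypothesis \<open>ex\<close> makes the search
  total.\<close>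

lemma total_recursive_Least:
  assumes "total_recursive \<Phi> (Suc k) (\<lambda>xs. of_bool (P (hd xs) (tl xs)))"
    and ex: "\<And>xs. length xs = k \<Longrightarrow> \<exists>n. P n xs"
  shows "total_recursive \<Phi> k (\<lambda>xs. LEAST n. P n xs)"
proof -
  have neg: "total_recursive \<Phi> (Suc k) (\<lambda>xs. rec_nat (Suc 0) (\<lambda>_ _. 0) (of_bool (P (hd xs) (tl xs))))"
    by (intro total_recursive_rec_nat total_recursive_const assms(1))
  define F where "F = (\<lambda>xs. if length xs = Suc k
    then Some (rec_nat (Suc 0) (\<lambda>_ _. 0) (of_bool (P (hd xs) (tl xs))) :: nat) else None)"
  have "precursive \<Phi> k (minimize F)"
    using neg by (intro precursive.mini) (simp add: total_recursive_def F_def)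
  moreover have F: "F (n # xs) = (if length xs = k then Some (if P n xs then 0 else 1) else None)"
    for n xs by (auto simp: F_def)
  have "minimize F = (\<lambda>xs. if length xs = k then Some (LEAST n. P n xs) else None)"
    using ex by (auto simp: minimize_def F fun_eq_iff)
  ultimately show ?thesis by (simp add: total_recursive_def)
qed

lemma total_recursive_if:
  assumes "total_recursive \<Phi> k (\<lambda>xs. of_bool (P xs))"
    and "total_recursive \<Phi> k f" and "total_recursive \<Phi> k g"
  shows "total_recursive \<Phi> k (\<lambda>xs. if P xs then f xs else g xs)"
proof -
  have "total_recursive \<Phi> k (\<lambda>xs. rec_nat (g xs) (\<lambda>_ _. f xs) (of_bool (P xs)))"
    by (intro total_recursive_rec_nat assms total_recursive_tl)
  then show ?thesis
    by (rule total_recursive_cong) auto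
qed

lemma total_recursive_diff:
  assumes "total_recursive \<Phi> k f" and "total_recursive \<Phi> k g"
  shows "total_recursive \<Phi> k (\<lambda>xs. f xs - g xs)"
proof -
  \<comment> \<open>The inner recursion returns its counter and so computes the predecessor, with
    value 0 at 0; iterating it gives truncated subtraction.\<close>
  have "total_recursive \<Phi> k (\<lambda>xs. rec_nat (f xs) (\<lambda>_ y. rec_nat 0 (\<lambda>n _. n) y) (g xs))"
    by (intro total_recursive_rec_nat assms total_recursive_const total_recursive_vars)
  moreover have "rec_nat 0 (\<lambda>n _. n) m = m - 1" for m :: nat
    by (cases m) auto
  moreover have "rec_nat a (\<lambda>_ y. y - 1) b = a - b" for a b :: nat
    by (induction b) auto
  ultimately show ?thesis by simp
qed

section \<open>Closure properties of recursive predicates\<close>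

lemma total_recursive_not:
  assumes "total_recursive \<Phi> k (\<lambda>xs. of_bool (P xs))"
  shows "total_recursive \<Phi> k (\<lambda>xs. of_bool (\<not> P xs))"
  using total_recursive_if[OF assms total_recursive_const[of _ _ 0] total_recursive_const[of _ _ 1]]
  by (rule total_recursive_cong) auto

lemma total_recursive_disj:
  assumes "total_recursive \<Phi> k (\<lambda>xs. of_bool (P xs))"
    and "total_recursive \<Phi> k (\<lambda>xs. of_bool (Q xs))"
  shows "total_recursive \<Phi> k (\<lambda>xs. of_bool (P xs \<or> Q xs))"
  using total_recursive_if[OF assms(1) total_recursive_const[of _ _ 1] assms(2)]
  by (rule total_recursive_cong) auto

text \<open>The recursion is the sign function, applied to the truncated difference.\<close>

lemma total_recursive_less:
  assumes "total_recursive \<Phi> k f" and "total_recursive \<Phi> k g"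
  shows "total_recursive \<Phi> k (\<lambda>xs. of_bool (f xs < g xs))"
proof -
  have "total_recursive \<Phi> k (\<lambda>xs. rec_nat 0 (\<lambda>_ _. 1) (g xs - f xs))"
    by (intro total_recursive_rec_nat total_recursive_const total_recursive_diff assms)
  moreover have "rec_nat 0 (\<lambda>_ _. 1) n = (of_bool (0 < n) :: nat)" for n
    by (cases n) auto
  ultimately show ?thesis by simp
qed

lemma total_recursive_eq:
  assumes "total_recursive \<Phi> k f" and "total_recursive \<Phi> k g"
  shows "total_recursive \<Phi> k (\<lambda>xs. of_bool (f xs = g xs))"
proof -
  have "total_recursive \<Phi> k (\<lambda>xs. of_bool (\<not> (f xs < g xs \<or> g xs < f xs)))"
    by (intro total_recursive_not total_recursive_disj total_recursive_less assms)
  then show ?thesis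
    by (rule total_recursive_cong) auto
qed

lemma total_recursive_bex:
  assumes "total_recursive \<Phi> (Suc k) (\<lambda>xs. of_bool (P (hd xs) (tl xs)))"
    and "total_recursive \<Phi> k b"
  shows "total_recursive \<Phi> k (\<lambda>xs. of_bool (\<exists>i<b xs. P i xs))"
proof -
  have "total_recursive \<Phi> (Suc (Suc k)) (\<lambda>xs. of_bool (P (hd xs) (tl (tl xs))))"
  proof -
    \<comment> \<open>In a recursion step the previous value sits between the counter and the
      parameters; these projections drop it, since \<open>P\<close> does not refer to it.\<close>
    define gs :: "(nat list \<Rightarrow> nat) list"
      where "gs = (\<lambda>xs. xs ! 0) # map (\<lambda>i xs. xs ! Suc (Suc i)) [0..<k]"
    have gs: "map (\<lambda>g. g xs) gs = hd xs # tl (tl xs)"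
      if "length xs = Suc (Suc k)" for xs :: "nat list"
      using that by (auto simp: gs_def length_Suc_conv intro!: nth_equalityI)
    have "total_recursive \<Phi> (Suc (Suc k))
        (\<lambda>xs. (\<lambda>ys. of_bool (P (hd ys) (tl ys))) (map (\<lambda>g. g xs) gs))"
      by (rule total_recursive_comp) (auto simp: gs_def assms intro: total_recursive_nth)
    then show ?thesis
      by (rule total_recursive_cong) (simp add: gs)
  qed
  then have "total_recursive \<Phi> k
      (\<lambda>xs. rec_nat 0 (\<lambda>n y. if P n xs then 1 else y) (b xs))"
    by (intro total_recursive_rec_nat total_recursive_if total_recursive_const
        total_recursive_vars assms)
  moreover have "rec_nat 0 (\<lambda>n y. if P n xs then 1 else y) m = (of_bool (\<exists>i<m. P i xs) :: nat)"
    for m xs by (induction m) (auto simp: less_Suc_eq)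
  ultimately show ?thesis by simp
qed

lemmas total_recursive_intros = total_recursive_vars total_recursive_const
  total_recursive_not total_recursive_disj total_recursive_less total_recursive_eq
  total_recursive_bex total_recursive_Suc total_recursive_diff

section \<open>Turing reducibility\<close>

lemma char_fun_eq: "char_fun A x = of_bool (x \<in> A)"
  by (simp add: char_fun_def)

lemma turing_reducible_iff:
  "turing_reducible A B \<longleftrightarrow> total_recursive {char_fun B} 1 (\<lambda>xs. of_bool (hd xs \<in> A))"
  unfolding turing_reducible_def computable_in_def char_fun_eq
  by (rule total_recursive_iff_precursive[symmetric])

lemma turing_reducible_trans:
  assumes "turing_reducible A B" and "turing_reducible B C"
  shows "turing_reducible A C"
proof -
  have "precursive {char_fun C} 1 (\<lambda>xs. if length xs = 1 then Some (char_fun B (hd xs)) else None)"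
    using assms(2) unfolding turing_reducible_iff total_recursive_def char_fun_eq .
  with assms(1) show ?thesis
    unfolding turing_reducible_iff total_recursive_def
    by (auto intro: precursive_subst)
qed

lemma turing_equivalent_trans:
  "turing_equivalent A B \<Longrightarrow> turing_equivalent B C \<Longrightarrow> turing_equivalent A C"
  unfolding turing_equivalent_def by (blast intro: turing_reducible_trans)

lemma finite_turing_reducible:
  assumes "finite A"
  shows "turing_reducible A B"
proof -
  have "total_recursive \<Phi> (Suc 0) (\<lambda>xs. of_bool (hd xs \<in> A))" for \<Phi>
    using assms
  proof (induction A)
    case (insert a A)
    then show ?case by (simp only: insert_iff) (intro total_recursive_intros)
  qed (simp add: total_recursive_const)
  then show ?thesis by (simp add: turing_reducible_iff)
qed

section \<open>Uniform sets are Turing equivalent\<close>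

text \<open>A listing of an infinite set is undefined only at 0, so precomposition with
  \<open>Suc\<close> makes it total. Needing no oracle, it is recursive relative to any.\<close>

lemma total_recursive_listing:
  assumes "listing h A" and "infinite A" and "total_recursive \<Phi> k f"
  shows "total_recursive \<Phi> k (\<lambda>xs. the (h (Suc (f xs))))"
proof -
  from assms obtain F where F: "precursive {} 1 F" "\<And>x. F [x] = h x" and dom: "dom h = positives"
    by (auto simp: listing_def computable_in_def)
  define S where "S = (\<lambda>xs::nat list. if length xs = 1 then Some (Suc (hd xs)) else None)"
  have "precursive \<Phi> 1 (pcompose 1 F [S])"
    using precursive_mono[OF F(1)] precursive.succ[of \<Phi>]
    by (intro precursive.comp) (auto simp: S_def)
  moreover have "pcompose 1 F [S] [x] = Some (the (h (Suc x)))" for x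
  proof -
    have "Suc x \<in> dom h" using dom by simp
    then show ?thesis by (auto simp: pcompose_def S_def F(2))
  qed
  ultimately have "total_recursive \<Phi> 1 (\<lambda>xs. the (h (Suc (hd xs))))"
    by (subst total_recursive_iff_precursive[of _ "\<lambda>x. the (h (Suc x))"]) blast
  then show ?thesis
    by (rule total_recursive_comp1[of _ "\<lambda>x. the (h (Suc x))"]) (rule assms(3))
qed

lemma listing_range:
  assumes "listing h A" and "infinite A"
  shows "range (\<lambda>i. the (h (Suc i))) = A"
proof -
  have "dom h = range Suc"
    using assms by (auto simp: listing_def image_def Suc_le_eq gr0_conv_Suc)
  moreover have "(\<lambda>i. the (h i)) ` dom h = A"
    using assms by (auto simp: listing_def bij_betw_def)
  ultimately show ?thesis by (simp add: image_image)
qed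

lemma uniform_turing_reducible:
  assumes "uniform B C"
  shows "turing_reducible C B"
proof (cases "finite B")
  case True
  with assms have "finite C" by (auto simp: uniform_def eqpoll_finite_iff)
  then show ?thesis by (rule finite_turing_reducible)
next
  case infB: False
  with assms have infC: "infinite C" by (auto simp: uniform_def eqpoll_finite_iff)
  from assms obtain h g where hg: "listing h B" "listing g C" "uniform_listings h g"
    by (auto simp: uniform_def)
  define h' where "h' i = the (h (Suc i))" for i
  define g' where "g' i = the (g (Suc i))" for i
  have B: "B = range h'" and C: "C = range g'"
    using listing_range[OF hg(1) infB] listing_range[OF hg(2) infC]
    by (simp_all add: h'_def g'_def)
  have mono: "h' i < h' j \<longleftrightarrow> g' i < g' j" for i j
  proof -
    have "Suc i \<in> dom h" "Suc j \<in> dom h" using hg(1) infB by (auto simp: listing_def)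
    with hg(3) show ?thesis by (simp add: uniform_listings_def h'_def g'_def)
  qed
  define i where "i x = (LEAST i. x < g' i)" for x
  \<comment> \<open>The bounded universal statement and the implication are spelled with negation,
    disjunction and bounded existence, the forms covered by \<open>total_recursive_intros\<close>.
    The test \<open>b \<notin> B\<close> is the oracle query.\<close>
  define N where "N x = (LEAST N. \<not> (\<exists>b<h' (i x). \<not> (b \<notin> B \<or> (\<exists>j<N. h' j = b))))" for x
  have ex_i: "\<exists>i. x < g' i" for x
    using infC unfolding C infinite_nat_iff_unbounded by blast
  have ex_N: "\<exists>N. \<not> (\<exists>b<h' (i x). \<not> (b \<notin> B \<or> (\<exists>j<N. h' j = b)))" for x
  proof -
    \<comment> \<open>One index for each of these finitely many elements gives a finite set
      \<open>J\<close>; any bound beyond \<open>J\<close> serves as \<open>N\<close>.\<close>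
    have "finite (B \<inter> {..<h' (i x)})" by simp
    moreover have "B \<inter> {..<h' (i x)} \<subseteq> h' ` UNIV" by (auto simp: B)
    ultimately obtain J where J: "finite J" "B \<inter> {..<h' (i x)} = h' ` J"
      by (meson finite_subset_image)
    then obtain N where "J \<subseteq> {..<N}" using finite_nat_iff_bounded by blast
    have "\<exists>j<N. h' j = b" if "b < h' (i x)" "b \<in> B" for b
    proof -
      from that J(2) have "b \<in> h' ` J" by blast
      with \<open>J \<subseteq> {..<N}\<close> show ?thesis by blast
    qed
    then show ?thesis by blast
  qed
  have C_iff: "x \<in> C \<longleftrightarrow> (\<exists>j<N x. g' j = x)" for x
  proof
    assume "x \<in> C"
    then obtain j where j: "g' j = x" unfolding C by blast
    have "x < g' (i x)" unfolding i_def by (rule LeastI_ex[OF ex_i])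
    then have "h' j < h' (i x)" by (simp add: mono j)
    moreover have "\<not> (\<exists>b<h' (i x). \<not> (b \<notin> B \<or> (\<exists>j<N x. h' j = b)))"
      unfolding N_def by (rule LeastI_ex[OF ex_N])
    ultimately obtain j' where "j' < N x" "h' j' = h' j" by (auto simp: B)
    \<comment> \<open>Equal \<open>h'\<close> values rule out both strict inequalities between the
      \<open>g'\<close> values, so trichotomy gives equality.\<close>
    moreover from this have "g' j' = g' j" using mono by (metis less_irrefl linorder_neqE_nat)
    ultimately show "\<exists>j<N x. g' j = x" using j by blast
  qed (auto simp: C)
  note rec_h = total_recursive_listing[OF hg(1) infB, folded h'_def]
  note rec_g = total_recursive_listing[OF hg(2) infC, folded g'_def]
  let ?\<Phi> = "{char_fun B}"
  have rec_B: "total_recursive ?\<Phi> k f \<Longrightarrow> total_recursive ?\<Phi> k (\<lambda>xs. of_bool (f xs \<in> B))" for k f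
    using total_recursive_oracle[of "char_fun B"] by (simp add: char_fun_eq)
  have "total_recursive ?\<Phi> 1 (\<lambda>xs. i (hd xs))"
    unfolding i_def One_nat_def
    by (intro total_recursive_Least total_recursive_intros rec_g ex_i)
  note rec_i = total_recursive_comp1[OF this]
  have "total_recursive ?\<Phi> 1 (\<lambda>xs. N (hd xs))"
    unfolding N_def One_nat_def
    by (intro total_recursive_Least total_recursive_intros rec_h rec_i rec_B ex_N)
  note rec_N = total_recursive_comp1[OF this]
  show ?thesis
    unfolding turing_reducible_iff C_iff One_nat_def
    by (intro total_recursive_intros rec_g rec_N)
qed

lemma uniform_sym: "uniform B C \<Longrightarrow> uniform C B"
  unfolding uniform_def uniform_listings_def by (metis eqpoll_sym)

lemma uniform_turing_equivalent: "uniform B C \<Longrightarrow> turing_equivalent B C"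
  by (simp add: turing_equivalent_def uniform_turing_reducible uniform_sym)

section \<open>Shifted copies\<close>

text \<open>Truncated subtraction makes membership visibly decidable from \<open>A\<close>. It sends
  every \<open>x \<le> Suc n\<close> to 0, which adds nothing when \<open>A\<close> consists of
  positive numbers.\<close>

definition marked_shift :: "nat \<Rightarrow> nat set \<Rightarrow> nat set" where
  "marked_shift n A = {x. x = n \<or> x - Suc n \<in> A}"

lemma marked_shift_eq:
  assumes "A \<subseteq> positives"
  shows "marked_shift n A = insert n ((\<lambda>x. x + Suc n) ` A)"
proof -
  have "x \<in> (\<lambda>x. x + Suc n) ` A" if "x - Suc n \<in> A" for x
  proof -
    from that assms have "x - Suc n \<ge> 1" by auto
    then have "x = (x - Suc n) + Suc n" by simp
    with that show ?thesis by blast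
  qed
  then show ?thesis by (auto simp: marked_shift_def)
qed

text \<open>The marker \<open>n\<close> is the least element of its set and can be read off from
  it.\<close>

lemma inj_marked_shift:
  assumes "A \<subseteq> positives"
  shows "inj (\<lambda>n. marked_shift n A)"
proof -
  have "(LEAST x. x \<in> marked_shift n A) = n" for n
    by (rule Least_equality) (auto simp: marked_shift_eq[OF assms])
  then show ?thesis by (metis injI)
qed

text \<open>One query suffices in each direction. For deciding \<open>A\<close>, the query
  \<open>x + Suc n\<close> never hits the marker \<open>n\<close>, and subtracting
  \<open>Suc n\<close> gives back \<open>x\<close> exactly.\<close>

lemma marked_shift_turing_equivalent: "turing_equivalent A (marked_shift n A)"
proof -
  let ?B = "marked_shift n A"
  have char: "total_recursive {char_fun X} k f
      \<Longrightarrow> total_recursive {char_fun X} k (\<lambda>xs. of_bool (f xs \<in> X))" for X k f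
    using total_recursive_oracle[of "char_fun X"] by (simp add: char_fun_eq)
  have "total_recursive {char_fun A} (Suc 0) (\<lambda>xs. of_bool (hd xs = n \<or> hd xs - Suc n \<in> A))"
    by (intro total_recursive_intros char)
  then have "turing_reducible ?B A"
    by (simp add: turing_reducible_iff marked_shift_def)
  moreover have "total_recursive \<Phi> (Suc 0) (\<lambda>xs. hd xs + m)" for \<Phi> m
    by (induction m) (auto intro: total_recursive_intros)
  then have "total_recursive {char_fun ?B} (Suc 0) (\<lambda>xs. of_bool (hd xs + Suc n \<in> ?B))"
    by (intro char)
  then have "turing_reducible A ?B"
    by (simp add: turing_reducible_iff marked_shift_def)
  ultimately show ?thesis by (simp add: turing_equivalent_def)
qed

text \<open>The domain of a partial function is at stake, so \<open>total_recursive_if\<close> does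
  not apply: the marker must be accepted even where \<open>F\<close> diverges on
  \<open>n - Suc n = 0\<close>.\<close>

lemma re_set_marked_shift:
  assumes "re_set A"
  shows "re_set (marked_shift n A)"
proof -
  from assms obtain F where F: "precursive {} 1 F" "dom (\<lambda>x. F [x]) = A"
    by (auto simp: re_set_def computable_in_def)
  define lift where "lift k f = (\<lambda>xs. if length xs = k then Some (f xs) else None)"
    for k and f :: "nat list \<Rightarrow> nat"
  have lift: "precursive {} k (lift k f)" if "total_recursive {} k f" for k f
    using that by (simp add: total_recursive_def lift_def)
  text \<open>Recursion on the truth value of \<open>x \<noteq> n\<close> evaluates \<open>F\<close> only if \<open>x \<noteq> n\<close>.\<close>
  define G where "G = pcompose 3 F [lift 3 (\<lambda>xs. hd (tl (tl xs)) - Suc n)]"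
  define H where "H = pcompose 1 (prim_rec (lift 1 (\<lambda>_. 0)) G)
    [lift 1 (\<lambda>xs. of_bool (hd xs \<noteq> n)), lift 1 (\<lambda>xs. hd xs)]"
  have "precursive {} 3 G"
    unfolding G_def using F(1)
    by (intro precursive.comp) (auto simp: eval_nat_numeral intro!: lift total_recursive_intros)
  then have "precursive {} (1 + 1) (prim_rec (lift 1 (\<lambda>_. 0)) G)"
    by (intro precursive.prim lift total_recursive_const) (simp add: eval_nat_numeral)
  then have "precursive {} 1 H"
    unfolding H_def
    by (intro precursive.comp) (auto simp: eval_nat_numeral intro!: lift total_recursive_intros)
  moreover have "dom (\<lambda>x. H [x]) = marked_shift n A"
  proof -
    have "H [x] \<noteq> None \<longleftrightarrow> x = n \<or> F [x - Suc n] \<noteq> None" for x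
      by (auto simp: H_def G_def lift_def pcompose_def)
    then show ?thesis using F(2) by (auto simp: marked_shift_def)
  qed
  ultimately show ?thesis
    unfolding re_set_def computable_in_def
    by (intro exI[of _ "\<lambda>x. H [x]"] conjI exI[of _ H]) simp_all
qed

theorem theorem3p7:
  fixes A :: "nat set"
  assumes "A \<subseteq> positives" and "re_set A"
  shows "infinite {B. B \<subseteq> positives \<and> re_set B \<and> uniformity_class B \<subseteq> turing_class A}"
proof -
  let ?S = "{B. B \<subseteq> positives \<and> re_set B \<and> uniformity_class B \<subseteq> turing_class A}"
  have "marked_shift n A \<in> ?S" if "n \<in> positives" for n
  proof -
    \<comment> \<open>Any set uniform to the shifted copy is Turing equivalent to it, hence to
      \<open>A\<close>.\<close>
    have "uniformity_class (marked_shift n A) \<subseteq> turing_class A"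
      unfolding uniformity_class_def turing_class_def
      using turing_equivalent_trans[OF marked_shift_turing_equivalent uniform_turing_equivalent]
      by blast
    moreover have "marked_shift n A \<subseteq> positives"
      \<comment> \<open>The marker belongs to the set, so \<open>n \<ge> 1\<close> keeps 0
        out.\<close>
      using that by (auto simp: marked_shift_eq[OF assms(1)])
    ultimately show ?thesis using re_set_marked_shift[OF assms(2)] by blast
  qed
  then have "(\<lambda>n. marked_shift n A) ` positives \<subseteq> ?S" by blast
  moreover have "infinite ((\<lambda>n. marked_shift n A) ` positives)"
    using inj_marked_shift[OF assms(1)] infinite_Ici[of "1::nat"]
    by (metis finite_imageD inj_on_subset subset_UNIV)
  ultimately show ?thesis by (rule infinite_super)
qed

end
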